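(* Let $n\ge 2$ be an integer, let $1>p_1\geq p_2\geq\cdots\geq p_n>0$ be real numbers, and let $\boldsymbol p=(p_1,p_2,\ldots,p_n)$. If $\frac23>p_2$ and $\mathcal A\subset 2^{[n]}$ is a $3$-wise intersecting family, then $\mu_{\boldsymbol p}(\mathcal A)\leq p_1$. Moreover, equality holds if and only if $\mathcal A$ is a star centered at some $i\in[n]$ with $p_i=p_1$.
   Context: $[n]=\{1,2,\ldots,n\}$ and $2^{[n]}$ is the family of all subsets of $[n]$. A family $\mathcal A\subset 2^{[n]}$ is $r$-wise intersecting if $A_1\cap A_2\cap\cdots\cap A_r\neq\emptyset$ for all (not necessarily distinct) $A_1,\ldots,A_r\in\mathcal A$. For $\boldsymbol p=(p_1,\ldots,p_n)\in(0,1)^n$ and $A\subset[n]$, $\mu_{\boldsymbol p}(A):=\prod_{i\in A}p_i\prod_{j\in[n]\setminus A}(1-p_j)$, and for a family $\mathcal A\subset 2^{[n]}$, $\mu_{\boldsymbol p}(\mathcal A):=\sum_{A\in\mathcal A}\mu_{\boldsymbol p}(A)$. The star centered at $i\in[n]$ is the family $\{A\in 2^{[n]}: i\in A\}$. *)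

theory Defs
  imports Complex_Main
begin

text \<open>The members of the family are indexed by \<open>{1..r}\<close> and need not be distinct.
  Only \<open>r \<ge> 1\<close> is meaningful, since \<open>\<Inter>{} = UNIV\<close>.\<close>

definition wise_intersecting :: "nat \<Rightarrow> 'a set set \<Rightarrow> bool" where
  "wise_intersecting r F \<longleftrightarrow>
     (\<forall>A :: nat \<Rightarrow> 'a set. (\<forall>k\<in>{1..r}. A k \<in> F) \<longrightarrow> (\<Inter>k\<in>{1..r}. A k) \<noteq> {})"

text \<open>The vector \<open>(p\<^sub>1, \<dots>, p\<^sub>n)\<close> is a function of which only the values on \<open>{1..n}\<close> are used.\<close>

definition mu_set :: "nat \<Rightarrow> (nat \<Rightarrow> real) \<Rightarrow> nat set \<Rightarrow> real" where
  "mu_set n p A = (\<Prod>i\<in>A. p i) * (\<Prod>j\<in>{1..n} - A. 1 - p j)"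

definition mu :: "nat \<Rightarrow> (nat \<Rightarrow> real) \<Rightarrow> nat set set \<Rightarrow> real" where
  "mu n p F = (\<Sum>A\<in>F. mu_set n p A)"

definition star :: "nat \<Rightarrow> nat \<Rightarrow> nat set set" where
  "star n i = {A \<in> Pow {1..n}. i \<in> A}"

end

theory Submission
  imports Defs "HOL-Library.FuncSet"
begin

text \<open>
  If all weights equal \<open>2 / 3\<close>, the measure counts colourings of the ground set with three colours:
  the set of points avoiding a fixed colour in a uniformly random colouring has exactly this
  distribution. The sets avoiding each of the three colours have no common point, so in every
  colouring at most two of the three belong to a \<open>3\<close>-wise intersecting family \<open>F\<close>, and averaging
  gives \<open>\<mu>(F) \<le> 2 / 3\<close>. In case of equality exactly two of them belong to \<open>F\<close> in every colouring.
  This says that among the blocks of any partition into three parts exactly one has its complement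
  outside \<open>F\<close>; such blocks form an ultrafilter on a finite set, hence a principal one, and \<open>F\<close> is a
  star (\<open>mu_two_thirds_le\<close>, \<open>mu_two_thirds_eq_imp_star\<close>).

  To pass to weights \<open>p\<^sub>i \<le> m \<le> 2 / 3\<close>, choose \<open>c\<close> with \<open>m\<^sup>c = 2 / 3\<close>, so that \<open>0 < c \<le> 1\<close> and
  \<open>p\<^sub>i\<^sup>c \<le> 2 / 3\<close>. For up-closed families, raising the weights in this way raises the measure at
  least to its own \<open>c\<close>-th power (\<open>mu_powr_le\<close>, an induction on \<open>n\<close> resting on the concavity of
  \<open>t \<mapsto> t\<^sup>c\<close>). Applied to the upward closure of \<open>F\<close>, this gives
  \<open>\<mu>\<^sub>p(F)\<^sup>c \<le> 2 / 3 = m\<^sup>c\<close>, and equality leads back to the equality case above.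

  There remains the case \<open>p\<^sub>1 > 2 / 3\<close>. Lowering \<open>p\<^sub>1\<close> to \<open>2 / 3\<close> costs no family more than it costs
  the star at \<open>1\<close>, namely \<open>p\<^sub>1 - 2 / 3\<close> (\<open>mu_diff_le_star_diff\<close>), so the bound for the lowered
  weights implies the bound for the given ones. Equality forces a star whose centre has lowered
  weight \<open>2 / 3\<close>, and as \<open>p\<^sub>2 < 2 / 3\<close> this centre is \<open>1\<close>.
\<close>

section \<open>Weights of sets and of stars\<close>

lemma mu_set_pos:
  assumes "\<And>i. i \<in> {1..n} \<Longrightarrow> 0 < p i \<and> p i < 1" and "A \<subseteq> {1..n}"
  shows "mu_set n p A > 0"
  unfolding mu_set_def using assms by (auto intro!: mult_pos_pos prod_pos)

lemma mu_mono:
  assumes "\<And>i. i \<in> {1..n} \<Longrightarrow> 0 < p i \<and> p i < 1" and "F \<subseteq> G" and "G \<subseteq> Pow {1..n}"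
  shows "mu n p F \<le> mu n p G"
proof -
  have "finite G"
    using assms(3) finite_subset by blast
  then show ?thesis
    unfolding mu_def
    using assms(2,3) mu_set_pos[OF assms(1)] by (intro sum_mono2) (auto intro!: less_imp_le)
qed

lemma mu_eq_imp_eq:
  assumes "\<And>i. i \<in> {1..n} \<Longrightarrow> 0 < p i \<and> p i < 1" and "F \<subseteq> G" and "G \<subseteq> Pow {1..n}"
    and "mu n p F = mu n p G"
  shows "F = G"
proof (rule ccontr)
  assume "F \<noteq> G"
  then obtain A where A: "A \<in> G" "A \<notin> F"
    using assms(2) by blast
  have fin: "finite G"
    using assms(3) finite_subset by blast
  have "mu n p F < mu n p G"
    unfolding mu_def
  proof (rule sum_strict_mono2[OF fin assms(2)])
    show "A \<in> G - F"
      using A by simp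
    show "0 < mu_set n p A"
      using A(1) assms(3) by (intro mu_set_pos assms(1)) auto
    show "0 \<le> mu_set n p B" if "B \<in> G" for B
      using that assms(3) by (intro less_imp_le[OF mu_set_pos[OF assms(1)]]) blast+
  qed
  with assms(4) show False by simp
qed

lemma mu_star:
  assumes "i \<in> {1..n}"
  shows "mu n p (star n i) = p i"
proof -
  \<comment> \<open>Expand the product of \<open>p j + g j\<close>: the zero at \<open>i\<close> removes exactly the sets avoiding \<open>i\<close>.\<close>
  define g where "g j = (if j = i then 0 else 1 - p j)" for j
  have "p i = (\<Prod>j\<in>{1..n}. p j + g j)"
  proof -
    have "(\<Prod>j\<in>{1..n}. p j + g j) = (\<Prod>j\<in>{1..n}. if j = i then p i else 1)"
      by (intro prod.cong) (auto simp: g_def)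
    then show ?thesis
      using assms by simp
  qed
  also have "\<dots> = (\<Sum>A\<in>Pow {1..n}. (\<Prod>j\<in>A. p j) * (\<Prod>j\<in>{1..n} - A. g j))"
    by (rule prod_add) simp
  also have "\<dots> = (\<Sum>A\<in>star n i. (\<Prod>j\<in>A. p j) * (\<Prod>j\<in>{1..n} - A. g j))"
  proof (intro sum.mono_neutral_right ballI)
    fix A assume "A \<in> Pow {1..n} - star n i"
    then have "i \<in> {1..n} - A"
      using assms by (auto simp: star_def)
    then have "(\<Prod>j\<in>{1..n} - A. g j) = 0"
      by (intro prod_zero) (auto simp: g_def)
    then show "(\<Prod>j\<in>A. p j) * (\<Prod>j\<in>{1..n} - A. g j) = 0"
      by simp
  qed (auto simp: star_def)
  also have "\<dots> = mu n p (star n i)"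
    unfolding mu_def mu_set_def
  proof (rule sum.cong)
    fix A assume "A \<in> star n i"
    then have "(\<Prod>j\<in>{1..n} - A. g j) = (\<Prod>j\<in>{1..n} - A. 1 - p j)"
      by (intro prod.cong) (auto simp: g_def star_def)
    then show "(\<Prod>j\<in>A. p j) * (\<Prod>j\<in>{1..n} - A. g j)
        = (\<Prod>j\<in>A. p j) * (\<Prod>j\<in>{1..n} - A. 1 - p j)"
      by simp
  qed simp
  finally show ?thesis ..
qed

section \<open>Threefold intersections\<close>

lemma wise_intersecting_3D:
  assumes "wise_intersecting 3 F" "A \<in> F" "B \<in> F" "C \<in> F"
  shows "A \<inter> B \<inter> C \<noteq> {}"
proof -
  let ?f = "\<lambda>k::nat. if k = 1 then A else if k = 2 then B else C"
  have "\<forall>k\<in>{1..3}. ?f k \<in> F"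
    using assms(2-4) by simp
  then have "(\<Inter>k\<in>{1..3}. ?f k) \<noteq> {}"
    using assms(1)[unfolded wise_intersecting_def, THEN spec] by (rule rev_mp)
  moreover have "{1..3} = {1, 2, 3::nat}"
    by auto
  ultimately show ?thesis
    by (simp add: Int_ac)
qed

lemma wise_intersecting_supersets:
  assumes "wise_intersecting r F" and "\<And>B. B \<in> G \<Longrightarrow> \<exists>A\<in>F. A \<subseteq> B"
  shows "wise_intersecting r G"
  unfolding wise_intersecting_def
proof (intro allI impI)
  fix B :: "nat \<Rightarrow> 'a set"
  assume "\<forall>k\<in>{1..r}. B k \<in> G"
  then have "\<forall>k\<in>{1..r}. \<exists>A. A \<in> F \<and> A \<subseteq> B k"
    using assms(2) by blast
  then obtain A where A: "\<forall>k\<in>{1..r}. A k \<in> F \<and> A k \<subseteq> B k"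
    by metis
  then have "(\<Inter>k\<in>{1..r}. A k) \<noteq> {}"
    using assms(1) unfolding wise_intersecting_def by blast
  moreover have "(\<Inter>k\<in>{1..r}. A k) \<subseteq> (\<Inter>k\<in>{1..r}. B k)"
    using A by blast
  ultimately show "(\<Inter>k\<in>{1..r}. B k) \<noteq> {}"
    by blast
qed

section \<open>The constant weight two thirds\<close>

text \<open>Three colours \<open>0, 1, 2\<close>; extensionality outside the ground set makes the colourings
  a finite set.\<close>

abbreviation colourings :: "nat \<Rightarrow> (nat \<Rightarrow> nat) set" where
  "colourings n \<equiv> {1..n} \<rightarrow>\<^sub>E {..<3}"

definition avoiding :: "nat \<Rightarrow> (nat \<Rightarrow> nat) \<Rightarrow> nat \<Rightarrow> nat set" where
  "avoiding n x c = {i \<in> {1..n}. x i \<noteq> c}"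

text \<open>Each point of \<open>A\<close> has two admissible colours and every other point has one, which leaves
  \<open>2\<^bsup>|A|\<^esup>\<close> colourings out of \<open>3\<^sup>n\<close>.\<close>

lemma card_colourings_avoiding_eq:
  assumes "c < 3" and "A \<subseteq> {1..n}"
  shows "real (card {x \<in> colourings n. avoiding n x c = A}) = 3 ^ n * mu_set n (\<lambda>_. 2 / 3) A"
proof -
  let ?T = "\<lambda>i. if i \<in> A then {..<3} - {c} else {c}"
  have "{x \<in> colourings n. avoiding n x c = A} = PiE {1..n} ?T"
  proof (intro equalityI subsetI)
    fix x assume "x \<in> {x \<in> colourings n. avoiding n x c = A}"
    then show "x \<in> PiE {1..n} ?T"
      by (auto simp: avoiding_def PiE_iff)
  next
    fix x assume x: "x \<in> PiE {1..n} ?T"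
    have "x i < 3 \<and> (x i \<noteq> c \<longleftrightarrow> i \<in> A)" if "i \<in> {1..n}" for i
      using PiE_mem[OF x that] assms(1) by (auto split: if_splits)
    then have "avoiding n x c = A" and "x \<in> colourings n"
      using x assms(2) unfolding avoiding_def PiE_iff by blast+
    then show "x \<in> {x \<in> colourings n. avoiding n x c = A}"
      by simp
  qed
  then have "card {x \<in> colourings n. avoiding n x c = A} = (\<Prod>i\<in>{1..n}. card (?T i))"
    by (simp add: card_PiE)
  also have "\<dots> = (\<Prod>i\<in>{1..n}. if i \<in> A then 2 else 1)"
    using assms(1) by (intro prod.cong) auto
  also have "\<dots> = 2 ^ card A"
    using assms(2) by (simp add: prod.If_cases Int_absorb1)
  finally have count: "card {x \<in> colourings n. avoiding n x c = A} = 2 ^ card A" .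
  have "card ({1..n} - A) + card A = n"
    using assms(2) card_Diff_subset[of A "{1..n}"] card_mono[of "{1..n}" A]
    by (simp add: finite_subset)
  then have "(3::real) ^ n = 3 ^ card A * 3 ^ card ({1..n} - A)"
    by (metis add.commute power_add)
  then have "3 ^ n * mu_set n (\<lambda>_. 2 / 3) A = 2 ^ card A"
    by (simp add: mu_set_def field_simps)
  then show ?thesis
    using count by simp
qed

lemma card_colourings_avoiding_in:
  assumes "c < 3" and "F \<subseteq> Pow {1..n}"
  shows "real (card {x \<in> colourings n. avoiding n x c \<in> F}) = 3 ^ n * mu n (\<lambda>_. 2 / 3) F"
proof -
  have fin: "finite F"
    using assms(2) finite_subset by blast
  have fc: "finite (colourings n)"
    by (simp add: finite_PiE)
  have "{x \<in> colourings n. avoiding n x c \<in> F}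
      = (\<Union>A\<in>F. {x \<in> colourings n. avoiding n x c = A})"
    by blast
  then have "card {x \<in> colourings n. avoiding n x c \<in> F}
      = (\<Sum>A\<in>F. card {x \<in> colourings n. avoiding n x c = A})"
    using fin fc by (simp only:) (intro card_UN_disjoint, auto)
  then have "real (card {x \<in> colourings n. avoiding n x c \<in> F})
      = (\<Sum>A\<in>F. real (card {x \<in> colourings n. avoiding n x c = A}))"
    by (simp only: of_nat_sum)
  also have "\<dots> = (\<Sum>A\<in>F. 3 ^ n * mu_set n (\<lambda>_. 2 / 3) A)"
    using assms by (intro sum.cong card_colourings_avoiding_eq) auto
  finally show ?thesis
    by (simp only: mu_def sum_distrib_left)
qed

text \<open>Double counting of the pairs of a colouring and a colour whose avoiding set lies in \<open>F\<close>.\<close>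

lemma sum_card_avoiding:
  assumes "F \<subseteq> Pow {1..n}"
  shows "real (\<Sum>x\<in>colourings n. card {c \<in> {..<3}. avoiding n x c \<in> F})
    = 3 * 3 ^ n * mu n (\<lambda>_. 2 / 3) F"
proof -
  have "(\<Sum>x\<in>colourings n. card {c \<in> {..<3}. avoiding n x c \<in> F})
      = (\<Sum>c\<in>{..<3}. card {x \<in> colourings n. avoiding n x c \<in> F})"
    by (rule sum_multicount_gen) (auto simp: finite_PiE)
  then have "real (\<Sum>x\<in>colourings n. card {c \<in> {..<3}. avoiding n x c \<in> F})
      = (\<Sum>c\<in>{..<3}. real (card {x \<in> colourings n. avoiding n x c \<in> F}))"
    by (simp only: of_nat_sum)
  also have "\<dots> = (\<Sum>c\<in>{..<3::nat}. 3 ^ n * mu n (\<lambda>_. 2 / 3) F)"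
    using assms by (intro sum.cong card_colourings_avoiding_in) auto
  finally show ?thesis
    by simp
qed

text \<open>A point common to the sets avoiding \<open>0\<close>, \<open>1\<close> and \<open>2\<close> would have no colour.\<close>

lemma card_avoiding_le_2:
  assumes "wise_intersecting 3 F" and "x \<in> colourings n"
  shows "card {c \<in> {..<3}. avoiding n x c \<in> F} \<le> 2"
proof (rule ccontr)
  assume "\<not> ?thesis"
  then have "card {..<3::nat} \<le> card {c \<in> {..<3}. avoiding n x c \<in> F}"
    by simp
  then have "{c \<in> {..<3}. avoiding n x c \<in> F} = {..<3}"
    by (intro card_seteq) auto
  then have "avoiding n x c \<in> F" if "c < 3" for c
    using that by blast
  then have "avoiding n x 0 \<in> F" "avoiding n x 1 \<in> F" "avoiding n x 2 \<in> F"
    by simp_all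
  from wise_intersecting_3D[OF assms(1) this]
  obtain i where i: "i \<in> {1..n}" "x i \<noteq> 0" "x i \<noteq> 1" "x i \<noteq> 2"
    by (auto simp: avoiding_def)
  have "x i < 3"
    using PiE_mem[OF assms(2) i(1)] by simp
  then show False
    using i by linarith
qed

lemma mu_two_thirds_le:
  assumes "F \<subseteq> Pow {1..n}" and "wise_intersecting 3 F"
  shows "mu n (\<lambda>_. 2 / 3) F \<le> 2 / 3"
proof -
  have "(\<Sum>x\<in>colourings n. card {c \<in> {..<3}. avoiding n x c \<in> F}) \<le> (\<Sum>x\<in>colourings n. 2)"
    by (rule sum_mono, rule card_avoiding_le_2[OF assms(2)])
  also have "\<dots> = 2 * 3 ^ n"
    by (simp add: card_PiE)
  finally have "real (\<Sum>x\<in>colourings n. card {c \<in> {..<3}. avoiding n x c \<in> F}) \<le> real (2 * 3 ^ n)"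
    by (rule of_nat_mono)
  then have "3 * 3 ^ n * mu n (\<lambda>_. 2 / 3) F \<le> 2 * 3 ^ n"
    by (simp only: sum_card_avoiding[OF assms(1)]) simp
  then show ?thesis
    by (simp add: field_simps)
qed

lemma card_avoiding_eq_2:
  assumes "F \<subseteq> Pow {1..n}" and "wise_intersecting 3 F" and "mu n (\<lambda>_. 2 / 3) F = 2 / 3"
    and "x \<in> colourings n"
  shows "card {c \<in> {..<3}. avoiding n x c \<in> F} = 2"
proof -
  have "real (\<Sum>x\<in>colourings n. card {c \<in> {..<3}. avoiding n x c \<in> F}) = real (2 * 3 ^ n)"
    unfolding sum_card_avoiding[OF assms(1)] assms(3) by simp
  then have "(\<Sum>x\<in>colourings n. card {c \<in> {..<3}. avoiding n x c \<in> F}) = 2 * 3 ^ n"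
    by (rule of_nat_eq_iff[THEN iffD1])
  also have "\<dots> = (\<Sum>x\<in>colourings n. 2)"
    by (simp add: card_PiE)
  finally show ?thesis
  proof (rule sum_mono_inv)
    show "finite (colourings n)"
      by (simp add: finite_PiE)
  qed (rule card_avoiding_le_2[OF assms(2)], assumption, rule assms(4))
qed

text \<open>The hypotheses say that \<open>D\<close> holds for exactly one block of every partition into three
  possibly empty blocks. Such a \<open>D\<close> is an ultrafilter: if \<open>B\<close> and \<open>C\<close> satisfy \<open>D\<close> but \<open>B \<inter> C\<close> does
  not, then the partition into \<open>B \<inter> C\<close>, \<open>B - C\<close> and the complement of \<open>B\<close> makes \<open>B - C\<close> satisfy
  \<open>D\<close>, although it is disjoint from \<open>C\<close>. On a finite set a member of least size is contained in
  all others, and any of its points is a centre.\<close>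

lemma principal_of_partition_property:
  assumes "finite V"
    and disj: "\<And>B C. B \<subseteq> V \<Longrightarrow> C \<subseteq> V \<Longrightarrow> B \<inter> C = {} \<Longrightarrow> \<not> (D B \<and> D C)"
    and ex: "\<And>B C. B \<subseteq> V \<Longrightarrow> C \<subseteq> V \<Longrightarrow> B \<inter> C = {} \<Longrightarrow> D B \<or> D C \<or> D (V - B - C)"
  shows "\<exists>i\<in>V. \<forall>B\<subseteq>V. D B \<longleftrightarrow> i \<in> B"
proof -
  have not_empty: "\<not> D {}"
    using disj[of "{}" "{}"] by simp
  have compl: "D (V - B) \<longleftrightarrow> \<not> D B" if "B \<subseteq> V" for B
    using ex[of B "{}"] disj[of B "V - B"] that not_empty by auto
  have inter: "D (B \<inter> C)" if "B \<subseteq> V" "C \<subseteq> V" "D B" "D C" for B C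
  proof (rule ccontr)
    assume "\<not> D (B \<inter> C)"
    moreover have "V - B \<inter> C - (B - C) = V - B"
      by auto
    ultimately have "D (B - C)"
      using ex[of "B \<inter> C" "B - C"] compl[of B] that by auto
    then show False
      using disj[of "B - C" C] that by auto
  qed
  have "D V"
    using compl[of "{}"] not_empty by simp
  then obtain M where M: "M \<subseteq> V" "D M" and min: "\<And>B. B \<subseteq> V \<Longrightarrow> D B \<Longrightarrow> card M \<le> card B"
    using ex_has_least_nat[of "\<lambda>B. B \<subseteq> V \<and> D B" V card] by blast
  have sub: "M \<subseteq> B" if "B \<subseteq> V" "D B" for B
  proof -
    have "card M \<le> card (M \<inter> B)"
      using M that by (intro min inter) auto
    then have "M \<inter> B = M"
      using M(1) assms(1) by (intro card_seteq) (auto intro: finite_subset)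
    then show ?thesis
      by blast
  qed
  obtain i where i: "i \<in> M"
    using M(2) not_empty by (cases "M = {}") auto
  have "D B \<longleftrightarrow> i \<in> B" if "B \<subseteq> V" for B
    using sub[of B] sub[of "V - B"] compl[of B] that i by auto
  then show ?thesis
    using i M(1) by blast
qed

text \<open>In the extremal case every colouring attains the bound two, so the sets whose complement lies
  outside \<open>F\<close> have the partition property; a partition is turned into the colouring by its blocks,
  for which the sets avoiding a colour are the complements of the blocks.\<close>

lemma mu_two_thirds_eq_imp_star:
  assumes "F \<subseteq> Pow {1..n}" and "wise_intersecting 3 F" and "mu n (\<lambda>_. 2 / 3) F = 2 / 3"
  shows "\<exists>i\<in>{1..n}. F = star n i"
proof -
  \<comment> \<open>\<open>D\<close> is the prospective ultrafilter; if \<open>F\<close> is the star at \<open>i\<close>, then \<open>D B\<close> means \<open>i \<in> B\<close>.\<close>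
  define D where "D B \<longleftrightarrow> {1..n} - B \<notin> F" for B
  have parts: "\<not> (D B \<and> D C) \<and> (D B \<or> D C \<or> D ({1..n} - B - C))"
    if "B \<subseteq> {1..n}" "C \<subseteq> {1..n}" "B \<inter> C = {}" for B C
  proof -
    define x where "x = (\<lambda>i\<in>{1..n}. if i \<in> B then 0 else if i \<in> C then 1 else 2::nat)"
    have x: "x \<in> colourings n"
      by (auto simp: x_def)
    have av: "avoiding n x 0 = {1..n} - B" "avoiding n x 1 = {1..n} - C"
      "avoiding n x 2 = {1..n} - ({1..n} - B - C)"
      using that by (auto simp: avoiding_def x_def)
    have D_av: "D B \<longleftrightarrow> avoiding n x 0 \<notin> F" "D C \<longleftrightarrow> avoiding n x 1 \<notin> F"
      "D ({1..n} - B - C) \<longleftrightarrow> avoiding n x 2 \<notin> F"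
      by (simp_all only: D_def av)
    let ?S = "{c \<in> {..<3}. avoiding n x c \<in> F}"
    have three: "{..<3::nat} = {0, 1, 2}"
      by auto
    have "card ?S = 2"
      by (rule card_avoiding_eq_2[OF assms x])
    moreover have "?S = (if D B then {} else {0}) \<union> (if D C then {} else {1})
        \<union> (if D ({1..n} - B - C) then {} else {2})"
      unfolding three D_av by (auto intro!: gr0I)
    ultimately show ?thesis
      by (auto split: if_splits)
  qed
  obtain i where i: "i \<in> {1..n}" "\<forall>B\<subseteq>{1..n}. D B \<longleftrightarrow> i \<in> B"
    using principal_of_partition_property[of "{1..n}" D] parts by blast
  have "A \<in> F \<longleftrightarrow> i \<in> A" if "A \<subseteq> {1..n}" for A
  proof -
    have "A \<in> F \<longleftrightarrow> \<not> D ({1..n} - A)"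
      using that by (simp add: D_def double_diff)
    then show ?thesis
      using i by auto
  qed
  then have "F = star n i"
    using assms(1) by (auto simp: star_def)
  then show ?thesis
    using i(1) by blast
qed

section \<open>Comparing an up-closed family under two vectors of weights\<close>

text \<open>Increments of the concave function \<open>t \<mapsto> t\<^sup>c\<close> shrink as the interval moves to the right. The
  left end stays positive so that the function is differentiable on the whole interval.\<close>

lemma powr_diff_antimono:
  fixes c d x y :: real
  assumes "0 < x" "x \<le> y" "0 \<le> d" "0 \<le> c" "c \<le> 1"
  shows "(y + d) powr c - y powr c \<le> (x + d) powr c - x powr c"
proof (rule DERIV_nonpos_imp_nonincreasing[OF assms(2)])
  fix t assume "x \<le> t" "t \<le> y"
  then have t: "t > 0"
    using assms(1) by linarith
  have "((\<lambda>t. (t + d) powr c - t powr c) has_real_derivative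
      c * (t + d) powr (c - 1) - c * t powr (c - 1)) (at t)"
    using t assms(3) by (auto intro!: derivative_eq_intros)
  moreover have "(t + d) powr (c - 1) \<le> t powr (c - 1)"
    using t assms(3,5) by (intro powr_mono2') auto
  then have "c * (t + d) powr (c - 1) - c * t powr (c - 1) \<le> 0"
    using assms(4) by (simp add: mult_left_mono)
  ultimately show "\<exists>z. ((\<lambda>t. (t + d) powr c - t powr c) has_real_derivative z) (at t) \<and> z \<le> 0"
    by blast
qed

text \<open>The two-point case of the comparison, where \<open>b\<close> and \<open>a\<close> stand for the measures of the two
  sections of an up-closed family. For \<open>r = q\<^sup>c\<close> it compares the increments of \<open>t \<mapsto> t\<^sup>c\<close> over
  two intervals of length \<open>q (b - a)\<close> starting at \<open>a\<close> and at \<open>q a \<le> a\<close>. A larger \<open>r\<close> only moves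
  weight from the smaller value \<open>a\<^sup>c\<close> to the larger value \<open>b\<^sup>c\<close>.\<close>

lemma powr_two_point:
  fixes a b c q r :: real
  assumes "0 \<le> a" "a \<le> b" "0 < q" "q < 1" "0 < c" "c \<le> 1" "q powr c \<le> r"
  shows "(q * b + (1 - q) * a) powr c \<le> r * b powr c + (1 - r) * a powr c"
proof -
  have "(q * b + (1 - q) * a) powr c \<le> q powr c * b powr c + (1 - q powr c) * a powr c"
  proof (cases "a = 0")
    case True
    then show ?thesis
      using assms by (simp add: powr_mult)
  next
    case False
    have "(a + q * (b - a)) powr c - a powr c \<le> (q * a + q * (b - a)) powr c - (q * a) powr c"
      using assms False by (intro powr_diff_antimono) (auto simp: mult_left_le_one_le)
    moreover have "a + q * (b - a) = q * b + (1 - q) * a" "q * a + q * (b - a) = q * b"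
      by (simp_all add: algebra_simps)
    ultimately show ?thesis
      using assms by (simp add: powr_mult algebra_simps)
  qed
  also have "\<dots> \<le> r * b powr c + (1 - r) * a powr c"
  proof -
    have "0 \<le> (r - q powr c) * (b powr c - a powr c)"
      using assms by (intro mult_nonneg_nonneg) (auto intro!: powr_mono2)
    then show ?thesis
      by (simp add: algebra_simps)
  qed
  finally show ?thesis .
qed

lemma mu_Suc:
  assumes "F \<subseteq> Pow {1..Suc n}"
  shows "mu (Suc n) p F = p (Suc n) * mu n p {A \<in> Pow {1..n}. insert (Suc n) A \<in> F}
    + (1 - p (Suc n)) * mu n p (F \<inter> Pow {1..n})"
proof -
  let ?V = "{1..n}"
  let ?F1 = "{A \<in> Pow ?V. insert (Suc n) A \<in> F}" and ?F0 = "F \<inter> Pow ?V"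
  have V: "{1..Suc n} = insert (Suc n) ?V"
    by auto
  have fin: "finite ?F1" "finite ?F0"
    by auto
  have "A \<in> insert (Suc n) ` ?F1 \<union> ?F0" if A: "A \<in> F" for A
  proof (cases "Suc n \<in> A")
    case True
    then have "A = insert (Suc n) (A - {Suc n})" "A - {Suc n} \<in> ?F1"
      using A assms unfolding V by (auto simp: insert_absorb)
    then show ?thesis
      by blast
  next
    case False
    then show ?thesis
      using A assms unfolding V by auto
  qed
  then have "F = insert (Suc n) ` ?F1 \<union> ?F0"
    by auto
  moreover have "insert (Suc n) ` ?F1 \<inter> ?F0 = {}"
    by auto
  ultimately have "mu (Suc n) p F
      = (\<Sum>A\<in>insert (Suc n) ` ?F1. mu_set (Suc n) p A) + (\<Sum>A\<in>?F0. mu_set (Suc n) p A)"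
    unfolding mu_def using fin by (metis (no_types, lifting) finite_imageI sum.union_disjoint)
  also have "(\<Sum>A\<in>insert (Suc n) ` ?F1. mu_set (Suc n) p A)
      = (\<Sum>A\<in>?F1. mu_set (Suc n) p (insert (Suc n) A))"
  proof (rule sum.reindex[unfolded o_def])
    show "inj_on (insert (Suc n)) ?F1"
    proof (rule inj_onI)
      fix A B assume "A \<in> ?F1" "B \<in> ?F1" "insert (Suc n) A = insert (Suc n) B"
      moreover from this have "Suc n \<notin> A" "Suc n \<notin> B"
        by auto
      ultimately show "A = B"
        by (simp add: insert_ident)
    qed
  qed
  also have "\<dots> = (\<Sum>A\<in>?F1. p (Suc n) * mu_set n p A)"
  proof (rule sum.cong[OF refl])
    fix A assume "A \<in> ?F1"
    then have A: "A \<subseteq> ?V" "Suc n \<notin> A" "finite A"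
      by (auto intro: finite_subset)
    then have "{1..Suc n} - insert (Suc n) A = ?V - A"
      unfolding V by auto
    with A show "mu_set (Suc n) p (insert (Suc n) A) = p (Suc n) * mu_set n p A"
      by (simp add: mu_set_def)
  qed
  also have "(\<Sum>A\<in>?F0. mu_set (Suc n) p A) = (\<Sum>A\<in>?F0. (1 - p (Suc n)) * mu_set n p A)"
  proof (rule sum.cong[OF refl])
    fix A assume "A \<in> ?F0"
    then have A: "A \<subseteq> ?V" "Suc n \<notin> A"
      by auto
    then have "{1..Suc n} - A = insert (Suc n) (?V - A)"
      unfolding V by auto
    then show "mu_set (Suc n) p A = (1 - p (Suc n)) * mu_set n p A"
      by (simp add: mu_set_def)
  qed
  finally show ?thesis
    by (simp add: mu_def sum_distrib_left)
qed

text \<open>The sets of \<open>F\<close> containing the last point and those avoiding it give two up-closed families on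
  the remaining points. Up-closure makes the second a subfamily of the first, which supplies the
  ordering \<open>a \<le> b\<close> of \<open>powr_two_point\<close>. A star at \<open>i\<close> attains equality when \<open>q\<^sub>i = p\<^sub>i\<^sup>c\<close>.\<close>

lemma mu_powr_le:
  assumes "\<And>i. i \<in> {1..n} \<Longrightarrow> 0 < p i \<and> p i < 1 \<and> p i powr c \<le> q i \<and> q i \<le> 1"
    and "0 < c" "c \<le> 1"
    and "F \<subseteq> Pow {1..n}"
    and "\<And>A B. A \<in> F \<Longrightarrow> A \<subseteq> B \<Longrightarrow> B \<subseteq> {1..n} \<Longrightarrow> B \<in> F"
  shows "mu n p F powr c \<le> mu n q F"
  using assms(1,4,5)
proof (induction n arbitrary: F)
  case 0
  then have "F = {} \<or> F = {{}}"
    by auto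
  then show ?case
    by (auto simp: mu_def mu_set_def)
next
  case (Suc n)
  let ?F1 = "{A \<in> Pow {1..n}. insert (Suc n) A \<in> F}" and ?F0 = "F \<inter> Pow {1..n}"
  let ?r = "q (Suc n)"
  have p01: "0 < p i \<and> p i < 1" if "i \<in> {1..n}" for i
    using Suc.prems(1)[of i] that by simp
  have pS: "0 < p (Suc n)" "p (Suc n) < 1" "p (Suc n) powr c \<le> ?r" "?r \<le> 1"
    using Suc.prems(1)[of "Suc n"] by auto
  have F0F1: "?F0 \<subseteq> ?F1"
  proof
    fix A assume A: "A \<in> ?F0"
    have "insert (Suc n) A \<in> F"
      by (rule Suc.prems(3)[of A]) (use A in auto)
    with A show "A \<in> ?F1"
      by blast
  qed
  have IH1: "mu n p ?F1 powr c \<le> mu n q ?F1"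
  proof (rule Suc.IH)
    fix A B assume "A \<in> ?F1" "A \<subseteq> B" "B \<subseteq> {1..n}"
    then show "B \<in> ?F1"
      using Suc.prems(3)[of "insert (Suc n) A" "insert (Suc n) B"] by fastforce
  qed (use Suc.prems(1) in auto)
  have IH0: "mu n p ?F0 powr c \<le> mu n q ?F0"
  proof (rule Suc.IH)
    fix A B assume "A \<in> ?F0" "A \<subseteq> B" "B \<subseteq> {1..n}"
    then show "B \<in> ?F0"
      using Suc.prems(3)[of A B] by fastforce
  qed (use Suc.prems(1) in auto)
  have "mu n p ?F0 \<le> mu n p ?F1"
    using p01 F0F1 by (intro mu_mono) auto
  moreover have "0 \<le> mu n p ?F0"
    unfolding mu_def by (intro sum_nonneg less_imp_le[OF mu_set_pos[OF p01]]) blast+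
  ultimately have "(p (Suc n) * mu n p ?F1 + (1 - p (Suc n)) * mu n p ?F0) powr c
      \<le> ?r * mu n p ?F1 powr c + (1 - ?r) * mu n p ?F0 powr c"
    using pS assms(2,3) by (intro powr_two_point) auto
  also have "\<dots> \<le> ?r * mu n q ?F1 + (1 - ?r) * mu n q ?F0"
  proof -
    have "0 \<le> ?r"
      using pS(3) powr_ge_zero order_trans by blast
    then show ?thesis
      using IH1 IH0 pS(4) by (intro add_mono mult_left_mono) auto
  qed
  finally show ?case
    unfolding mu_Suc[OF Suc.prems(2)] .
qed

section \<open>Assembling the bound\<close>

text \<open>The upward closure \<open>G\<close> replaces \<open>F\<close> because the comparison of weights requires an up-closed
  family. In the equality case \<open>G\<close> is a star, and \<open>F\<close> has the measure of \<open>G\<close>, hence is all of \<open>G\<close>,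
  since every set has positive measure.\<close>

lemma mu_le_max_weight:
  assumes p: "\<And>i. i \<in> {1..n} \<Longrightarrow> 0 < p i \<and> p i \<le> m"
    and m: "0 < m" "m \<le> 2 / 3"
    and F: "F \<subseteq> Pow {1..n}" "wise_intersecting 3 F"
  shows "mu n p F \<le> m" and "mu n p F = m \<Longrightarrow> \<exists>i\<in>{1..n}. p i = m \<and> F = star n i"
proof -
  define c where "c = log m (2 / 3)"
  have mc: "m powr c = 2 / 3"
    using m by (simp add: c_def)
  have "0 < c"
    using m by (auto simp: c_def log_def intro!: divide_neg_neg)
  have "c \<le> 1"
  proof -
    have "ln m \<le> ln (2 / 3)" "ln m < 0"
      using m by auto
    then show ?thesis
      by (simp add: c_def log_def divide_le_eq)
  qed
  define G where "G = {B \<in> Pow {1..n}. \<exists>A\<in>F. A \<subseteq> B}"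
  have G: "G \<subseteq> Pow {1..n}" "F \<subseteq> G"
    using F(1) by (auto simp: G_def)
  have wG: "wise_intersecting 3 G"
    using F(2) by (rule wise_intersecting_supersets) (auto simp: G_def)
  have p01: "0 < p i \<and> p i < 1" if "i \<in> {1..n}" for i
    using p[OF that] m(2) by linarith
  have pc: "p i powr c \<le> 2 / 3" if "i \<in> {1..n}" for i
    using p[OF that] \<open>0 < c\<close> unfolding mc[symmetric] by (intro powr_mono2) auto
  have FG: "mu n p F \<le> mu n p G"
    using p01 G by (intro mu_mono)
  have le: "mu n p G powr c \<le> mu n (\<lambda>_. 2 / 3) G"
  proof (rule mu_powr_le[OF _ \<open>0 < c\<close> \<open>c \<le> 1\<close> G(1)])
    fix A B assume "A \<in> G" "A \<subseteq> B" "B \<subseteq> {1..n}"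
    then show "B \<in> G"
      unfolding G_def by blast
  qed (use p01 pc in auto)
  have le23: "mu n (\<lambda>_. 2 / 3) G \<le> 2 / 3"
    using G(1) wG by (rule mu_two_thirds_le)
  have Gm: "mu n p G \<le> m"
  proof (rule ccontr)
    assume "\<not> ?thesis"
    then have "m powr c < mu n p G powr c"
      using m \<open>0 < c\<close> by (intro powr_less_mono2) auto
    then show False
      using le le23 mc by linarith
  qed
  show "mu n p F \<le> m"
    using FG Gm by linarith
  assume eq: "mu n p F = m"
  then have "mu n p G = m"
    using FG Gm by linarith
  then have "mu n (\<lambda>_. 2 / 3) G = 2 / 3"
    using le le23 mc by simp
  then obtain i where i: "i \<in> {1..n}" "G = star n i"
    using mu_two_thirds_eq_imp_star[OF G(1) wG] by blast
  moreover have "F = G"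
    using mu_eq_imp_eq[OF p01 G(2,1)] eq \<open>mu n p G = m\<close> by simp
  moreover have "p i = m"
    using mu_star[OF i(1), of p] \<open>mu n p G = m\<close> i(2) by simp
  ultimately show "\<exists>i\<in>{1..n}. p i = m \<and> F = star n i"
    by blast
qed

text \<open>Lowering the weight of \<open>k\<close> decreases the measure of the sets containing \<open>k\<close> and increases that
  of the others. The loss is therefore largest for the family of all sets containing \<open>k\<close>, which is
  the star.\<close>

lemma mu_diff_le_star_diff:
  assumes p: "\<And>i. i \<in> {1..n} \<Longrightarrow> 0 < p i \<and> p i < 1"
    and k: "k \<in> {1..n}" "t \<le> p k"
    and F: "F \<subseteq> Pow {1..n}"
  shows "mu n p F - mu n (p(k := t)) F \<le> p k - t"
proof -
  let ?q = "p(k := t)"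
  let ?d = "\<lambda>A. mu_set n p A - mu_set n ?q A"
  \<comment> \<open>The measure of \<open>A\<close> without its factor at \<open>k\<close>, common to both vectors of weights.\<close>
  define w where "w A = (\<Prod>i\<in>A - {k}. p i) * (\<Prod>j\<in>{1..n} - A - {k}. 1 - p j)" for A
  have w: "0 \<le> w A" if "A \<subseteq> {1..n}" for A
    unfolding w_def using p that
    by (intro mult_nonneg_nonneg prod_nonneg) (auto intro!: less_imp_le)
  have eq: "mu_set n v A = (if k \<in> A then v k else 1 - v k) * w A"
    if A: "A \<subseteq> {1..n}" and v: "\<And>i. i \<noteq> k \<Longrightarrow> v i = p i" for A v
  proof -
    have fin: "finite A"
      using A finite_subset by blast
    have "(\<Prod>i\<in>A - {k}. v i) = (\<Prod>i\<in>A - {k}. p i)"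
      by (intro prod.cong) (auto simp: v)
    moreover have "(\<Prod>j\<in>{1..n} - A - {k}. 1 - v j) = (\<Prod>j\<in>{1..n} - A - {k}. 1 - p j)"
      by (intro prod.cong) (auto simp: v)
    moreover have "(\<Prod>i\<in>A. v i) = (if k \<in> A then v k else 1) * (\<Prod>i\<in>A - {k}. v i)"
      using fin by (auto simp: prod.remove)
    moreover have "(\<Prod>j\<in>{1..n} - A. 1 - v j)
        = (if k \<in> A then 1 else 1 - v k) * (\<Prod>j\<in>{1..n} - A - {k}. 1 - v j)"
      using k(1) prod.remove[of "{1..n} - A" k "\<lambda>j. 1 - v j"] by auto
    ultimately have "mu_set n v A
        = ((if k \<in> A then v k else 1) * (if k \<in> A then 1 else 1 - v k)) * w A"
      unfolding mu_set_def w_def by (simp only: ac_simps)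
    then show ?thesis
      by simp
  qed
  have d: "?d A = (if k \<in> A then p k - t else t - p k) * w A" if "A \<subseteq> {1..n}" for A
    using eq[OF that, of p] eq[OF that, of ?q] by (simp add: algebra_simps)
  have fin: "finite F" "finite (star n k)"
    using F finite_subset by (blast, simp add: star_def)
  have "mu n p F - mu n ?q F = (\<Sum>A\<in>F. ?d A)"
    by (simp add: mu_def sum_subtractf)
  also have "\<dots> \<le> (\<Sum>A\<in>F \<inter> star n k. ?d A)"
  proof -
    have "?d A \<le> 0" if "A \<in> F - star n k" for A
    proof -
      have A: "A \<subseteq> {1..n}" "k \<notin> A"
        using that F by (auto simp: star_def)
      show ?thesis
        unfolding d[OF A(1)] using A(2) k(2) w[OF A(1)] by (simp add: mult_nonpos_nonneg)
    qed
    then have "(\<Sum>A\<in>F - star n k. ?d A) \<le> 0"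
      by (intro sum_nonpos) auto
    then show ?thesis
      using sum.Int_Diff[OF fin(1), of ?d "star n k"] by linarith
  qed
  also have "\<dots> \<le> (\<Sum>A\<in>star n k. ?d A)"
  proof (rule sum_mono2)
    fix A assume "A \<in> star n k - F \<inter> star n k"
    then have A: "A \<subseteq> {1..n}" "k \<in> A"
      by (auto simp: star_def)
    show "0 \<le> ?d A"
      unfolding d[OF A(1)] using A(2) k(2) w[OF A(1)] by simp
  qed (use fin in auto)
  also have "\<dots> = mu n p (star n k) - mu n ?q (star n k)"
    by (simp add: mu_def sum_subtractf)
  also have "\<dots> = p k - t"
    using k(1) by (simp add: mu_star)
  finally show ?thesis .
qed

theorem theorem2:
  fixes n :: nat and p :: "nat \<Rightarrow> real" and F :: "nat set set"
  assumes "n \<ge> 2"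
    and "1 > p 1"
    and "\<And>i. 1 \<le> i \<Longrightarrow> i < n \<Longrightarrow> p i \<ge> p (i + 1)"
    and "p n > 0"
    and "2 / 3 > p 2"
    and "F \<subseteq> Pow {1..n}"
    and "wise_intersecting 3 F"
  shows "mu n p F \<le> p 1 \<and>
    (mu n p F = p 1 \<longleftrightarrow> (\<exists>i\<in>{1..n}. p i = p 1 \<and> F = star n i))"
proof -
  have anti: "p j \<le> p i" if "1 \<le> i" "i \<le> j" "j \<le> n" for i j
    using that(2,3)
  proof (induction j rule: dec_induct)
    case (step j)
    then show ?case
      using assms(3)[of j] that(1) by simp
  qed simp
  have p: "0 < p i \<and> p i \<le> p 1" if "i \<in> {1..n}" for i
    using anti[of i n] anti[of 1 i] that assms(4) by auto
  have p2: "p i < 2 / 3" if "i \<in> {1..n}" "i \<noteq> 1" for i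
    using anti[of 2 i] that assms(5) by auto
  have one: "1 \<in> {1..n}"
    using assms(1) by simp
  have "mu n p F \<le> p 1 \<and> (mu n p F = p 1 \<longrightarrow> (\<exists>i\<in>{1..n}. p i = p 1 \<and> F = star n i))"
  proof (cases "p 1 \<le> 2 / 3")
    case True
    then show ?thesis
      using mu_le_max_weight[of n p "p 1" F] p p[OF one] assms(6,7) by blast
  next
    case False
    let ?q = "p(1 := 2 / 3)"
    have diff: "mu n p F - mu n ?q F \<le> p 1 - 2 / 3"
    proof (rule mu_diff_le_star_diff[OF _ one _ assms(6)])
      show "0 < p i \<and> p i < 1" if "i \<in> {1..n}" for i
        using p[OF that] assms(2) by linarith
    qed (use False in simp)
    have q: "0 < ?q i \<and> ?q i \<le> 2 / 3" if "i \<in> {1..n}" for i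
      using p[OF that] p2[OF that] by auto
    have q_le: "mu n ?q F \<le> 2 / 3"
      by (rule mu_le_max_weight(1)[of n ?q "2 / 3", OF q _ _ assms(6,7)]) simp_all
    have "F = star n 1" if "mu n p F = p 1"
    proof -
      have "mu n ?q F = 2 / 3"
        using diff that q_le by linarith
      then have "\<exists>i\<in>{1..n}. ?q i = 2 / 3 \<and> F = star n i"
        using mu_le_max_weight(2)[of n ?q "2 / 3", OF q _ _ assms(6,7)] by linarith
      then obtain i where i: "i \<in> {1..n}" "?q i = 2 / 3" "F = star n i"
        by blast
      then have "i = 1"
        using p2[of i] by (auto split: if_splits)
      with i show ?thesis
        by simp
    qed
    then show ?thesis
      using diff q_le one by fastforce
  qed
  moreover have "mu n p F = p 1" if "\<exists>i\<in>{1..n}. p i = p 1 \<and> F = star n i"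
    using that mu_star by auto
  ultimately show ?thesis
    by blast
qed

end
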